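(* Fix $d\ge 3$, $c>0$ and $1\le\delta<d-1$, let $p=(c+o_n(1))n^{-d+1+\delta}$ and let $\mathcal{H}$ be the random $d$-uniform hypergraph on $[n]$ with each $d$-subset a hyperedge independently with probability $p$. Then the weighted partial recovery loss is $1-o_n(1)$.
   Context: $\mathrm{Proj}_W(H)$ is the weighted graph on $[n]$ where $\{i,j\}$ has weight equal to the number of hyperedges containing it. The weighted partial recovery loss is $\min_{\mathcal{B}_W}\mathbb{E}[|\mathcal{B}_W(\mathrm{Proj}_W(\mathcal{H}))\Delta E(\mathcal{H})|]/(p\binom nd)$ over all functions $\mathcal{B}_W$ from weighted projections to sets of $d$-subsets of $[n]$. *)

theory Defs
  imports "HOL-Probability.Probability" "HOL-Library.Ramsey"
begin

text \<open>
  A \<open>d\<close>-uniform hypergraph on the vertex set \<open>[n] = {1..n}\<close> is identified with its set of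
  hyperedges, a subset of \<open>nsets {1..n} d\<close>.
\<close>

definition hypergraphs :: "nat \<Rightarrow> nat \<Rightarrow> nat set set set" where
  "hypergraphs n d = Pow (nsets {1..n} d)"

text \<open>
  \<open>bernoulli_pmf\<close> clips its argument to \<open>[0, 1]\<close>, so \<open>q\<close> is the hyperedge probability only
  when \<open>0 \<le> q \<le> 1\<close>.
\<close>

definition random_hypergraph :: "nat \<Rightarrow> nat \<Rightarrow> real \<Rightarrow> nat set set pmf" where
  "random_hypergraph n d q =
     map_pmf (\<lambda>f. {h \<in> nsets {1..n} d. f h})
       (Pi_pmf (nsets {1..n} d) False (\<lambda>_. bernoulli_pmf q))"

text \<open>
  A weighted graph on \<open>[n]\<close> is its weight function on unordered pairs. Restricting it to
  2-subsets matters: the same count taken at other sets (for instance at hyperedges) is not part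
  of the projection.
\<close>

definition weighted_projection :: "nat \<Rightarrow> nat set set \<Rightarrow> (nat set \<Rightarrow> nat)" where
  "weighted_projection n H = (\<lambda>e \<in> nsets {1..n} 2. card {h \<in> H. e \<subseteq> h})"

definition weighted_decoders :: "nat \<Rightarrow> nat \<Rightarrow> ((nat set \<Rightarrow> nat) \<Rightarrow> nat set set) set" where
  "weighted_decoders n d =
     weighted_projection n ` hypergraphs n d \<rightarrow>\<^sub>E Pow (nsets {1..n} d)"

definition weighted_partial_loss :: "nat \<Rightarrow> nat \<Rightarrow> real \<Rightarrow> real" where
  "weighted_partial_loss n d q =
     Min ((\<lambda>B. measure_pmf.expectation (random_hypergraph n d q)
                 (\<lambda>H. real (card (sym_diff (B (weighted_projection n H)) H)))
               / (q * real (n choose d)))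
          ` weighted_decoders n d)"

text \<open>The minimum above is over a finite nonempty set.\<close>

lemma finite_weighted_decoders: "finite (weighted_decoders n d)"
  by (simp add: weighted_decoders_def hypergraphs_def finite_PiE finite_imp_finite_nsets)

lemma weighted_decoders_nonempty: "weighted_decoders n d \<noteq> {}"
  by (auto simp: weighted_decoders_def PiE_eq_empty_iff)

end

(*
  Gibbs' inequality compares the law P of the hypergraph with the likelihood Q of a code that
  transmits the projection W(H) by independent geometric variables of parameter 1/2, one for each
  pair, and then the difference between H and the guess B(W(H)) as if it were itself a sample of P.
  With N = (n choose d) and m = p N, the geometric part costs ln 2 ((n choose 2) + (d choose 2) m)
  on average, because each hyperedge contributes to (d choose 2) pairs. The remaining terms of
  ln Q - ln P are (|H| - |B(W(H)) - H|) ln ((1 - p) / p), the inner minus being the symmetric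
  difference, so the expected error is at least m minus the geometric cost over ln ((1 - p) / p).
  As delta >= 1, the mean m is at least of order n^2, so that cost is O(m), while
  ln ((1 - p) / p) tends to infinity. The empty guess gives the matching upper bound.
*)

theory Submission
  imports Defs "HOL-Real_Asymp.Real_Asymp"
begin

section \<open>Relative entropy and geometric weights\<close>

lemma Gibbs_inequality:
  fixes M :: "'a pmf"
  assumes fin: "finite (set_pmf M)"
    and pos: "\<And>x. x \<in> set_pmf M \<Longrightarrow> Q x > 0"
    and le1: "(\<Sum>x\<in>set_pmf M. Q x) \<le> 1"
  shows "measure_pmf.expectation M (\<lambda>x. ln (Q x) - ln (pmf M x)) \<le> 0"
proof -
  have "measure_pmf.expectation M (\<lambda>x. ln (Q x) - ln (pmf M x))
      = (\<Sum>x\<in>set_pmf M. (ln (Q x) - ln (pmf M x)) * pmf M x)"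
    by (intro integral_measure_pmf_real) (use fin in auto)
  also have "\<dots> \<le> (\<Sum>x\<in>set_pmf M. Q x - pmf M x)"
  proof (rule sum_mono)
    fix x assume x: "x \<in> set_pmf M"
    then have p: "pmf M x > 0" by (simp add: pmf_positive)
    have "ln (Q x) - ln (pmf M x) = ln (Q x / pmf M x)"
      using p pos[OF x] by (simp add: ln_div)
    \<comment> \<open>After multiplication by \<open>pmf M x\<close> the logarithm is gone and only
      total masses are compared, so a subprobability \<open>Q\<close> suffices.\<close>
    also have "\<dots> \<le> Q x / pmf M x - 1"
      using p pos[OF x] by (intro ln_le_minus_one) simp
    finally have "(ln (Q x) - ln (pmf M x)) * pmf M x \<le> (Q x / pmf M x - 1) * pmf M x"
      using p by (intro mult_right_mono) auto
    then show "(ln (Q x) - ln (pmf M x)) * pmf M x \<le> Q x - pmf M x"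
      using p by (simp add: left_diff_distrib)
  qed
  also have "\<dots> \<le> 0"
    using le1 sum_pmf_eq_1[OF fin, of M] by (simp add: sum_subtractf)
  finally show ?thesis .
qed

text \<open>The summand is the product over \<open>e\<close> of the geometric masses
  \<open>(1/2) ^ Suc (w e)\<close>. Extensionality makes distinct members of \<open>W\<close> differ
  on \<open>E\<close>, so no outcome is counted twice.\<close>

lemma sum_geometric_weights_le_1:
  fixes W :: "('a \<Rightarrow> nat) set"
  assumes fin: "finite E" "finite W" and W: "W \<subseteq> extensional E"
  shows "(\<Sum>w\<in>W. (1 / 2 :: real) ^ (card E + (\<Sum>e\<in>E. w e))) \<le> 1"
proof -
  \<comment> \<open>A common bound on all values puts \<open>W\<close> inside a finite box, where
    the sum of products factorises.\<close>
  obtain K where K: "\<And>w e. w \<in> W \<Longrightarrow> e \<in> E \<Longrightarrow> w e < K"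
  proof -
    have "finite ((\<lambda>(w, e). w e) ` (W \<times> E))" using fin by simp
    then obtain K where "\<forall>x\<in>(\<lambda>(w, e). w e) ` (W \<times> E). x < K"
      using finite_nat_set_iff_bounded by auto
    then show ?thesis using that by force
  qed
  have geo: "(\<Sum>k<K. (1 / 2 :: real) ^ Suc k) \<le> 1"
  proof -
    have "(\<Sum>k<K. (1 / 2 :: real) ^ Suc k) = 1 - (1/2) ^ K" by (induction K) auto
    then show ?thesis by simp
  qed
  have "(\<Sum>w\<in>W. (1 / 2 :: real) ^ (card E + (\<Sum>e\<in>E. w e))) = (\<Sum>w\<in>W. \<Prod>e\<in>E. (1 / 2) ^ Suc (w e))"
    by (simp add: power_add power_sum prod.distrib prod_dividef power_one_over)
  also have "\<dots> \<le> (\<Sum>w\<in>PiE E (\<lambda>_. {..<K}). \<Prod>e\<in>E. (1 / 2) ^ Suc (w e))"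
    using fin W K by (intro sum_mono2 finite_PiE prod_nonneg) (auto simp: PiE_def)
  also have "\<dots> = (\<Prod>e\<in>E. \<Sum>k<K. (1 / 2) ^ Suc k)"
    using fin by (subst prod_sum_PiE) auto
  also have "\<dots> \<le> 1"
    using geo by (intro prod_le_1) (auto intro!: sum_nonneg)
  finally show ?thesis .
qed

section \<open>Hypergraphs, projections and decoders\<close>

lemma finite_hypergraphs: "finite (hypergraphs n d)"
  by (simp add: hypergraphs_def finite_imp_finite_nsets)

text \<open>Double counting of incidences between pairs and hyperedges. It makes the cost of the
  geometric code affine in \<open>card H\<close>.\<close>

lemma sum_weighted_projection:
  assumes "H \<in> hypergraphs n d"
  shows "(\<Sum>e\<in>nsets {1..n} 2. weighted_projection n H e) = (d choose 2) * card H"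
proof -
  have fin: "finite (nsets {1..n} 2)" by (simp add: finite_imp_finite_nsets)
  have H: "H \<subseteq> nsets {1..n} d" using assms by (simp add: hypergraphs_def)
  then have finH: "finite H" by (rule finite_subset) (simp add: finite_imp_finite_nsets)
  have "(\<Sum>e\<in>nsets {1..n} 2. weighted_projection n H e)
      = (\<Sum>e\<in>nsets {1..n} 2. card {h \<in> H. e \<subseteq> h})"
    by (simp add: weighted_projection_def)
  also have "\<dots> = (d choose 2) * card H"
  proof (rule sum_multicount[OF fin finH], rule ballI)
    fix h assume "h \<in> H"
    then have h: "h \<subseteq> {1..n}" "finite h" "card h = d" using H by (auto simp: nsets_def)
    then have "{e \<in> nsets {1..n} 2. e \<subseteq> h} = nsets h 2" by (auto simp: nsets_def)
    then show "card {e \<in> nsets {1..n} 2. e \<subseteq> h} = d choose 2"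
      using h by simp
  qed
  finally show ?thesis .
qed

lemma decoder_in_hypergraphs:
  "B \<in> weighted_decoders n d \<Longrightarrow> H \<in> hypergraphs n d \<Longrightarrow>
     B (weighted_projection n H) \<in> hypergraphs n d"
  unfolding weighted_decoders_def hypergraphs_def by (drule PiE_mem) auto

lemma sym_diff_in_hypergraphs:
  "A \<in> hypergraphs n d \<Longrightarrow> H \<in> hypergraphs n d \<Longrightarrow> sym_diff A H \<in> hypergraphs n d"
  by (auto simp: hypergraphs_def)

section \<open>The law of the random hypergraph\<close>

context
  fixes n d :: nat and q :: real
  assumes q: "0 < q" "q < 1"
begin

lemma pmf_random_hypergraph:
  assumes "H \<in> hypergraphs n d"
  shows "pmf (random_hypergraph n d q) H = q ^ card H * (1 - q) ^ ((n choose d) - card H)"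
proof -
  let ?V = "nsets {1..n} d"
  let ?P = "Pi_pmf ?V False (\<lambda>_. bernoulli_pmf q)"
  let ?g = "\<lambda>f. {h \<in> ?V. f h}"
  have fin: "finite ?V" by (simp add: finite_imp_finite_nsets)
  have H: "H \<subseteq> ?V" using assms by (simp add: hypergraphs_def)
  then have finH: "finite H" using fin finite_subset by blast
  \<comment> \<open>Functions in the support are \<open>False\<close> outside \<open>?V\<close>, so
    the selected subset of \<open>?V\<close> determines them.\<close>
  have "inj_on ?g (set_pmf ?P)"
    by (rule inj_onI) (use set_Pi_pmf_subset[OF fin] in \<open>fastforce simp: fun_eq_iff\<close>)
  moreover have "(\<lambda>h. h \<in> H) \<in> set_pmf ?P"
    unfolding set_Pi_pmf[OF fin] using H q by (auto simp: PiE_dflt_def set_pmf_bernoulli)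
  ultimately have "pmf (map_pmf ?g ?P) (?g (\<lambda>h. h \<in> H)) = pmf ?P (\<lambda>h. h \<in> H)"
    by (rule pmf_map_inj)
  also have "?g (\<lambda>h. h \<in> H) = H" using H by auto
  also have "pmf ?P (\<lambda>h. h \<in> H) = (\<Prod>h\<in>?V. pmf (bernoulli_pmf q) (h \<in> H))"
    using H by (intro pmf_Pi' fin) auto
  also have "\<dots> = (\<Prod>h\<in>?V. if h \<in> H then q else 1 - q)"
    using q by (intro prod.cong) auto
  also have "\<dots> = q ^ card H * (1 - q) ^ card (?V - H)"
    using fin H by (simp add: prod.If_cases Int_absorb1 Diff_eq flip: Collect_neg_eq)
  finally show ?thesis
    using card_Diff_subset[OF finH H] by (simp add: random_hypergraph_def)
qed

text \<open>Full support, from \<open>0 < q < 1\<close>, keeps every likelihood positive, so that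
  its logarithm may be taken.\<close>

lemma set_pmf_random_hypergraph: "set_pmf (random_hypergraph n d q) = hypergraphs n d"
proof
  show "set_pmf (random_hypergraph n d q) \<subseteq> hypergraphs n d"
    by (auto simp: random_hypergraph_def hypergraphs_def)
  show "hypergraphs n d \<subseteq> set_pmf (random_hypergraph n d q)"
    using q by (auto simp: set_pmf_iff pmf_random_hypergraph)
qed

lemma integrable_random_hypergraph:
  "integrable (measure_pmf (random_hypergraph n d q)) (f :: nat set set \<Rightarrow> real)"
  by (simp add: integrable_measure_pmf_finite set_pmf_random_hypergraph finite_hypergraphs)

lemma expectation_card_random_hypergraph:
  "measure_pmf.expectation (random_hypergraph n d q) (\<lambda>H. real (card H)) = q * real (n choose d)"
proof -
  let ?V = "nsets {1..n} d"
  let ?P = "Pi_pmf ?V False (\<lambda>_. bernoulli_pmf q)"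
  have fin: "finite ?V" by (simp add: finite_imp_finite_nsets)
  have fP: "finite (set_pmf ?P)"
    by (subst set_Pi_pmf[OF fin]) (auto intro!: finite_PiE_dflt finite_imp_finite_nsets)
  have "real (card {h \<in> ?V. f h}) = (\<Sum>h\<in>?V. of_bool (f h))" for f
    using sum.inter_filter[OF fin, of "\<lambda>_. 1 :: real" f] by (simp add: of_bool_def)
  then have "measure_pmf.expectation (random_hypergraph n d q) (\<lambda>H. real (card H))
      = measure_pmf.expectation ?P (\<lambda>f. \<Sum>h\<in>?V. of_bool (f h))"
    unfolding random_hypergraph_def integral_map_pmf by (simp only:)
  also have "\<dots> = (\<Sum>h\<in>?V. measure_pmf.expectation ?P (\<lambda>f. of_bool (f h)))"
    by (intro Bochner_Integration.integral_sum integrable_measure_pmf_finite fP)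
  also have "\<dots> = (\<Sum>h\<in>?V. q)"
  proof (rule sum.cong[OF refl])
    fix h assume h: "h \<in> ?V"
    have "measure_pmf.expectation ?P (\<lambda>f. of_bool (f h))
        = measure_pmf.expectation (map_pmf (\<lambda>f. f h) ?P) (of_bool :: bool \<Rightarrow> real)"
      by simp
    also have "map_pmf (\<lambda>f. f h) ?P = bernoulli_pmf q"
      using h by (subst Pi_pmf_component[OF fin]) simp
    finally show "measure_pmf.expectation ?P (\<lambda>f. of_bool (f h)) = q"
      using q by simp
  qed
  finally show ?thesis by simp
qed

section \<open>The code for projection and difference, and the error bound it yields\<close>

definition code_weight :: "((nat set \<Rightarrow> nat) \<Rightarrow> nat set set) \<Rightarrow> nat set set \<Rightarrow> real" where
  "code_weight B H =
     (1 / 2) ^ ((n choose 2) + (\<Sum>e\<in>nsets {1..n} 2. weighted_projection n H e)) *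
     pmf (random_hypergraph n d q) (sym_diff (B (weighted_projection n H)) H)"

text \<open>On a fibre of the projection the guess is constant, so the differences from it are
  distinct hypergraphs and their masses sum to at most 1. What remains is one geometric weight per
  projection: the exponent adds \<open>w e + 1\<close> over all \<open>n choose 2\<close>
  pairs.\<close>

lemma sum_code_weight_le_1:
  assumes B: "B \<in> weighted_decoders n d"
  shows "(\<Sum>H\<in>hypergraphs n d. code_weight B H) \<le> 1"
proof -
  let ?X = "hypergraphs n d" and ?E = "nsets {1..n} 2"
  let ?W = "weighted_projection n" and ?pr = "pmf (random_hypergraph n d q)"
  let ?G = "\<lambda>w. (1 / 2 :: real) ^ ((n choose 2) + (\<Sum>e\<in>?E. w e))"
  have total: "(\<Sum>H\<in>?X. ?pr (sym_diff A H)) = 1" if A: "A \<in> ?X" for A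
  proof -
    have "(\<Sum>H\<in>?X. ?pr (sym_diff A H)) = (\<Sum>H\<in>?X. ?pr H)"
      \<comment> \<open>Symmetric difference with \<open>A\<close> is an involution on the
        hypergraphs, hence its own inverse.\<close>
      by (rule sum.reindex_bij_witness[where i = "sym_diff A" and j = "sym_diff A"])
        (use A in \<open>auto simp: hypergraphs_def\<close>)
    also have "\<dots> = 1"
      by (intro sum_pmf_eq_1 finite_hypergraphs) (simp add: set_pmf_random_hypergraph)
    finally show ?thesis .
  qed
  have "(\<Sum>H\<in>?X. code_weight B H) = (\<Sum>w\<in>?W ` ?X. \<Sum>H | H \<in> ?X \<and> ?W H = w. code_weight B H)"
    by (rule sum.image_gen[OF finite_hypergraphs])
  also have "\<dots> \<le> (\<Sum>w\<in>?W ` ?X. ?G w)"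
  proof (rule sum_mono)
    fix w assume "w \<in> ?W ` ?X"
    then have Bw: "B w \<in> ?X" using decoder_in_hypergraphs[OF B] by auto
    have "(\<Sum>H | H \<in> ?X \<and> ?W H = w. code_weight B H)
        = ?G w * (\<Sum>H | H \<in> ?X \<and> ?W H = w. ?pr (sym_diff (B w) H))"
      unfolding sum_distrib_left by (rule sum.cong) (auto simp: code_weight_def)
    also have "\<dots> \<le> ?G w * (\<Sum>H\<in>?X. ?pr (sym_diff (B w) H))"
      by (intro mult_left_mono sum_mono2 finite_hypergraphs) auto
    also have "\<dots> = ?G w" using total[OF Bw] by simp
    finally show "(\<Sum>H | H \<in> ?X \<and> ?W H = w. code_weight B H) \<le> ?G w" .
  qed
  also have "\<dots> \<le> 1"
    using sum_geometric_weights_le_1[of ?E "?W ` ?X"] finite_hypergraphs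
    by (simp add: finite_imp_finite_nsets weighted_projection_def image_subset_iff)
  finally show ?thesis .
qed

lemma code_weight_pos:
  assumes "B \<in> weighted_decoders n d" "H \<in> hypergraphs n d"
  shows "code_weight B H > 0"
  using q sym_diff_in_hypergraphs[OF decoder_in_hypergraphs[OF assms] assms(2)]
  by (simp add: code_weight_def pmf_random_hypergraph)

text \<open>The log-likelihood is affine in the number of hyperedges, so comparing two hypergraphs
  cancels the constant and leaves a difference of sizes.\<close>

lemma ln_pmf_random_hypergraph:
  assumes "H \<in> hypergraphs n d"
  shows "ln (pmf (random_hypergraph n d q) H)
    = real (n choose d) * ln (1 - q) - real (card H) * ln ((1 - q) / q)"
proof -
  have "card H \<le> n choose d"
    using assms card_mono[of "nsets {1..n} d" H]
    by (simp add: hypergraphs_def finite_imp_finite_nsets)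
  then show ?thesis
    using q assms
    by (simp add: pmf_random_hypergraph ln_mult ln_div ln_realpow of_nat_diff algebra_simps)
qed

lemma expected_error_ge:
  assumes B: "B \<in> weighted_decoders n d" and half: "q < 1 / 2"
  shows "measure_pmf.expectation (random_hypergraph n d q)
           (\<lambda>H. real (card (sym_diff (B (weighted_projection n H)) H)))
         \<ge> q * real (n choose d)
           - (real (n choose 2) + real (d choose 2) * (q * real (n choose d))) * ln 2 / ln ((1 - q) / q)"
proof -
  let ?M = "random_hypergraph n d q"
  let ?err = "\<lambda>H. real (card (sym_diff (B (weighted_projection n H)) H))"
  define L where "L = ln ((1 - q) / q)"
  \<comment> \<open>As \<open>q < 1/2\<close>, the odds \<open>(1 - q) / q\<close> exceed 1; the
    final division by \<open>L\<close> then preserves the inequality.\<close>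
  have L: "L > 0" using q half by (simp add: L_def ln_gt_zero)
  have "measure_pmf.expectation ?M (\<lambda>H. ln (code_weight B H) - ln (pmf ?M H)) \<le> 0"
    using sum_code_weight_le_1[OF B] code_weight_pos[OF B] finite_hypergraphs
    by (intro Gibbs_inequality) (simp_all add: set_pmf_random_hypergraph)
  also have "measure_pmf.expectation ?M (\<lambda>H. ln (code_weight B H) - ln (pmf ?M H))
    = measure_pmf.expectation ?M (\<lambda>H. (real (card H) - ?err H) * L
        - (real (n choose 2) + real (d choose 2) * real (card H)) * ln 2)"
  proof (intro integral_cong_AE, simp, simp, rule AE_pmfI)
    fix H assume "H \<in> set_pmf ?M"
    then have H: "H \<in> hypergraphs n d" by (simp add: set_pmf_random_hypergraph)
    note S = sym_diff_in_hypergraphs[OF decoder_in_hypergraphs[OF B H] H]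
    have "pmf ?M (sym_diff (B (weighted_projection n H)) H) > 0"
      using S q by (simp add: pmf_random_hypergraph)
    then have "ln (code_weight B H)
        = real ((n choose 2) + (d choose 2) * card H) * ln (1 / 2)
          + ln (pmf ?M (sym_diff (B (weighted_projection n H)) H))"
      unfolding code_weight_def sum_weighted_projection[OF H]
      by (subst ln_mult) (simp_all add: ln_realpow)
    moreover have ln_half: "ln (1 / 2 :: real) = - ln 2" by (simp add: ln_div)
    ultimately show "ln (code_weight B H) - ln (pmf ?M H) = (real (card H) - ?err H) * L
        - (real (n choose 2) + real (d choose 2) * real (card H)) * ln 2"
      unfolding ln_pmf_random_hypergraph[OF S] ln_pmf_random_hypergraph[OF H] L_def[symmetric]
      by (simp only: ln_half of_nat_add of_nat_mult) (simp only: algebra_simps)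
  qed
  also have "\<dots> = (q * real (n choose d) - measure_pmf.expectation ?M ?err) * L
        - (real (n choose 2) + real (d choose 2) * (q * real (n choose d))) * ln 2"
    by (simp add: integrable_random_hypergraph expectation_card_random_hypergraph)
  finally show ?thesis
    using L unfolding L_def[symmetric] by (simp add: field_simps)
qed

section \<open>Bounds on the loss for fixed \<open>n\<close>\<close>

lemma weighted_partial_loss_le_1:
  assumes "d \<le> n"
  shows "weighted_partial_loss n d q \<le> 1"
proof -
  \<comment> \<open>The empty guess errs exactly on the hyperedges of \<open>H\<close>. It is
    restricted to actual projections in order to be extensional.\<close>
  let ?B = "\<lambda>w\<in>weighted_projection n ` hypergraphs n d. {} :: nat set set"
  have B: "?B \<in> weighted_decoders n d"
    by (auto simp: weighted_decoders_def)
  have "weighted_partial_loss n d q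
      \<le> measure_pmf.expectation (random_hypergraph n d q)
          (\<lambda>H. real (card (sym_diff (?B (weighted_projection n H)) H))) / (q * real (n choose d))"
    unfolding weighted_partial_loss_def
    by (rule Min_le[OF finite_imageI[OF finite_weighted_decoders]]) (rule image_eqI[OF refl B])
  also have "measure_pmf.expectation (random_hypergraph n d q)
          (\<lambda>H. real (card (sym_diff (?B (weighted_projection n H)) H)))
      = measure_pmf.expectation (random_hypergraph n d q) (\<lambda>H. real (card H))"
    \<comment> \<open>On the support the projection lies in the domain of \<open>?B\<close>, so the
      guess is the empty set and not \<open>undefined\<close>.\<close>
    by (intro integral_cong_AE, simp, simp, rule AE_pmfI) (simp add: set_pmf_random_hypergraph)
  also have "\<dots> / (q * real (n choose d)) = 1"
    using q assms by (simp add: expectation_card_random_hypergraph)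
  finally show ?thesis .
qed

text \<open>The error bound does not depend on the decoder, so after division by the positive mean
  it passes to the minimum.\<close>

lemma weighted_partial_loss_ge:
  assumes "d \<le> n" and "q < 1 / 2"
  shows "weighted_partial_loss n d q
    \<ge> 1 - (real (n choose 2) / (q * real (n choose d)) + real (d choose 2)) * ln 2 / ln ((1 - q) / q)"
proof -
  have pos: "q * real (n choose d) > 0" using q assms by simp
  have scale: "1 - (a / m + b) * l / L = (m - (a + b * m) * l / L) / m" if "m > 0" for a b l L m :: real
    using that by (simp add: diff_divide_distrib add_divide_distrib distrib_right)
  have "1 - (real (n choose 2) / (q * real (n choose d)) + real (d choose 2)) * ln 2 / ln ((1 - q) / q)
      \<le> measure_pmf.expectation (random_hypergraph n d q)
           (\<lambda>H. real (card (sym_diff (B (weighted_projection n H)) H))) / (q * real (n choose d))"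
    if "B \<in> weighted_decoders n d" for B
  proof -
    let ?m = "q * real (n choose d)"
    have "1 - (real (n choose 2) / ?m + real (d choose 2)) * ln 2 / ln ((1 - q) / q)
      = (?m - (real (n choose 2) + real (d choose 2) * ?m) * ln 2 / ln ((1 - q) / q)) / ?m"
      by (rule scale[OF pos])
    also have "\<dots> \<le> measure_pmf.expectation (random_hypergraph n d q)
           (\<lambda>H. real (card (sym_diff (B (weighted_projection n H)) H))) / ?m"
      using pos expected_error_ge[OF that assms(2)] by (intro divide_right_mono) auto
    finally show ?thesis .
  qed
  then show ?thesis
    unfolding weighted_partial_loss_def
    by (subst Min_ge_iff) (auto simp: finite_weighted_decoders weighted_decoders_nonempty)
qed

end

section \<open>Asymptotics in the sparse regime\<close>

theorem theorem19:
  fixes d :: nat and c \<delta> :: real and p \<epsilon> :: "nat \<Rightarrow> real"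
  assumes "d \<ge> 3"
    and "c > 0"
    and "1 \<le> \<delta>" and "\<delta> < real d - 1"
    and "\<epsilon> \<longlonglongrightarrow> 0"
    and "\<And>n. n \<ge> 1 \<Longrightarrow> p n = (c + \<epsilon> n) * real n powr (- real d + 1 + \<delta>)"
  shows "(\<lambda>n. weighted_partial_loss n d (p n)) \<longlonglongrightarrow> 1"
proof -
  have "(\<lambda>n. c + \<epsilon> n) \<longlonglongrightarrow> c"
    using tendsto_add[OF tendsto_const assms(5)] by simp
  \<comment> \<open>The exponent is negative because \<open>\<delta> < d - 1\<close>.\<close>
  moreover have "(\<lambda>n. real n powr (- real d + 1 + \<delta>)) \<longlonglongrightarrow> 0"
    using assms(4) by (intro tendsto_neg_powr filterlim_real_sequentially) auto
  ultimately have "(\<lambda>n. (c + \<epsilon> n) * real n powr (- real d + 1 + \<delta>)) \<longlonglongrightarrow> c * 0"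
    by (rule tendsto_mult)
  then have p0: "p \<longlonglongrightarrow> 0"
    unfolding mult_zero_right
    by (rule Lim_transform_eventually) (auto simp: assms(6) intro!: eventually_sequentiallyI[of 1])
  \<comment> \<open>Any constant strictly between 0 and \<open>c\<close> would do;
    \<open>c / 2\<close> is the source of the factor \<open>2 / c\<close> below.\<close>
  have ev_eps: "\<forall>\<^sub>F n in sequentially. c + \<epsilon> n > c / 2"
    using \<open>(\<lambda>n. c + \<epsilon> n) \<longlonglongrightarrow> c\<close> assms(2) by (intro order_tendstoD(1)) auto
  have ev_pos: "\<forall>\<^sub>F n in sequentially. 0 < p n"
    using ev_eps eventually_ge_at_top[of 1]
    by eventually_elim (use assms(2) in \<open>auto simp: assms(6)\<close>)
  have ev_half: "\<forall>\<^sub>F n in sequentially. p n < 1 / 2"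
    using p0 by (intro order_tendstoD(2)) auto
  define C where "C = (2 / c * real d ^ d + real (d choose 2)) * ln 2"
  \<comment> \<open>Here \<open>\<delta> \<ge> 1\<close> enters: \<open>p n\<close> is at least
    \<open>c / 2\<close> times \<open>n\<close> to the power \<open>2 - d\<close>, and
    \<open>n choose d\<close> is at least \<open>(n / d) ^ d\<close>. Their product is of order
    \<open>n ^ 2\<close> or larger and so dominates the number of pairs.\<close>
  have ratio: "\<forall>\<^sub>F n in sequentially. real (n choose 2) / (p n * real (n choose d)) \<le> 2 / c * real d ^ d"
    using ev_eps ev_pos eventually_ge_at_top[of d] eventually_ge_at_top[of 1]
  proof eventually_elim
    case (elim n)
    have n: "real n > 0" using elim by simp
    have "c / 2 * real n powr (2 - real d) \<le> p n"
      unfolding assms(6)[OF \<open>1 \<le> n\<close>] using elim assms(2,3)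
      by (intro mult_mono powr_mono) auto
    moreover have "real n powr (real d) / real d ^ d \<le> real (n choose d)"
      using binomial_ge_n_over_k_pow_k[of d n, where ?'a = real] elim n
      by (simp add: power_divide powr_realpow)
    ultimately have "c / 2 * real n powr (2 - real d) * (real n powr (real d) / real d ^ d)
        \<le> p n * real (n choose d)"
      using elim assms(2) by (intro mult_mono) auto
    moreover have "real n powr (2 - real d) * real n powr (real d) = real n ^ 2"
      using n by (simp flip: powr_add)
    ultimately have m: "c / (2 * real d ^ d) * real n ^ 2 \<le> p n * real (n choose d)"
      by (simp add: field_simps)
    have "real (n choose 2) \<le> real n ^ 2"
      using binomial_le_pow[of 2 n] elim assms(1) by (simp flip: of_nat_power)
    also have "\<dots> \<le> 2 / c * real d ^ d * (p n * real (n choose d))"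
      using m assms(1,2) by (simp add: field_simps)
    finally show ?case
      using elim by (simp add: pos_divide_le_eq)
  qed
  \<comment> \<open>Eventual positivity makes the limit one-sided, as needed for the log-odds to
    tend to infinity.\<close>
  have "filterlim p (at_right 0) sequentially"
    using p0 ev_pos by (auto simp: filterlim_at elim: eventually_mono)
  moreover have "filterlim (\<lambda>x::real. ln ((1 - x) / x)) at_top (at_right 0)"
    by real_asymp
  ultimately have "filterlim (\<lambda>n. ln ((1 - p n) / p n)) at_top sequentially"
    by (rule filterlim_compose[rotated])
  then have "(\<lambda>n. C / ln ((1 - p n) / p n)) \<longlonglongrightarrow> 0"
    by (intro tendsto_divide_0[OF tendsto_const] filterlim_at_top_imp_at_infinity)
  then have lower: "(\<lambda>n. 1 - C / ln ((1 - p n) / p n)) \<longlonglongrightarrow> 1"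
    using tendsto_diff[OF tendsto_const[of 1]] by fastforce
  show ?thesis
  proof (rule tendsto_sandwich[OF _ _ lower tendsto_const])
    show "\<forall>\<^sub>F n in sequentially. weighted_partial_loss n d (p n) \<le> 1"
      using ev_pos ev_half eventually_ge_at_top[of d]
      by eventually_elim (rule weighted_partial_loss_le_1, auto)
    show "\<forall>\<^sub>F n in sequentially. 1 - C / ln ((1 - p n) / p n) \<le> weighted_partial_loss n d (p n)"
      using ev_pos ev_half eventually_ge_at_top[of d] ratio
    proof eventually_elim
      case (elim n)
      \<comment> \<open>A positive denominator lets the bound \<open>C\<close> on the numerator pass
        through the quotient.\<close>
      have "ln ((1 - p n) / p n) > 0" using elim by (simp add: ln_gt_zero)
      then have "(real (n choose 2) / (p n * real (n choose d)) + real (d choose 2)) * ln 2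
          / ln ((1 - p n) / p n) \<le> C / ln ((1 - p n) / p n)"
        unfolding C_def using elim by (intro divide_right_mono mult_right_mono add_right_mono) auto
      then show ?case
        using weighted_partial_loss_ge[of "p n" d n] elim by simp
    qed
  qed
qed

end
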